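(* Let $k$ be a field and order the free commutative semiring $Rig[x]$ on one generator $x$ by the ordering $<$ described in the context. Let $S$ consist of the following relations: 1. $1\circ x^2=x$, 2. $x\circ x^4=1\circ x^3$, 3. $x^5=1\circ x^4$, 4. $1\circ x^3\circ x^n=x^n$ $(3\leq n\leq 4)$. Then $kRig[x\,|\,x=1\circ x^2]=kRig[x\,|\,S]$, and $S$ is a Gröbner-Shirshov basis in $kRig[x]$.
   Context: A commutative semiring $(A,\circ,\cdot,\theta,1)$ consists of two commutative monoids $(A,\circ,\theta)$ and $(A,\cdot,1)$ such that $\theta\cdot a=\theta$ for all $a$ and $\cdot$ distributes over $\circ$. $Rig[x]$ is the free commutative semiring on one generator $x$ (so $Rig[x]\cong\mathbb N[x]$ with $\circ$ as addition, $\theta$ as zero); with $[x]=\{x^n\mid n\ge0\}$, its elements (monomials) are the finite multisets $u_1\circ\cdots\circ u_n$ with $u_i\in[x]$, $n\ge0$ ($n=0$ gives $\theta$). $kRig[x]$ is the $k$-vector space with basis $Rig[x]$, with $\circ$ and $\cdot$ extended bilinearly. An ideal of $kRig[x]$ is an ideal with respect to both operations $\circ$ and $\cdot$; $Id(S)$ is the ideal generated by $S$, and $kRig[x|S]=kRig[x]/Id(S)$. A relation $u=v$ ($u,v\in Rig[x]$) is identified with the polynomial $u-v\in kRig[x]$. The equality $kRig[x|R]=kRig[x|S]$ means $Id(R)=Id(S)$. Ordering: order $[x]$ by $x^n\prec x^m\Leftrightarrow n<m$. For $u=u_1\circ\cdots\circ u_n\in Rig[x]$ with $u_i\in[x]$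 and $u_1\preceq\cdots\preceq u_n$, let $wt(u)=(u_n,u_{n-1},\dots,u_1)$. For $u,v\in Rig[x]$: if neither of the sequences $wt(u),wt(v)$ is a prefix of the other, then $u<v$ iff $wt(u)<wt(v)$ lexicographically; if $wt(u)$ is a proper prefix of $wt(v)$, then $u<v$. This is a monomial ordering. For a nonzero polynomial $f$, $\bar f$ is its leading (largest) monomial; $f$ is monic if $\bar f$ has coefficient $1$. For monomials $u=w_1\circ\cdots\circ w_m\circ u_{m+1}\circ\cdots\circ u_n$ and $v=w_1\circ\cdots\circ w_m\circ v_{m+1}\circ\cdots\circ v_t$ with all $w_l,u_i,v_j\in[x]$ and $u_i\ne v_j$ for all $i,j>m$, put $lcm_\circ(u,v)=w_1\circ\cdots\circ w_m\circ u_{m+1}\circ\cdots\circ u_n\circ v_{m+1}\circ\cdots\circ v_t$. Compositions: let $f,g$ be monic with $\bar f=u_1\circ\cdots\circ u_n$, $\bar g=v_1\circ\cdots\circ v_m$, $u_i,v_j\in[x]$. For each pair $(i,j)$ let $a,b\in[x]$ be the elements such that $au_i=bv_j$ is the least common multiple of $u_i$ and $v_j$ in $[x]$. The corresponding composition is $(f,g)_w=af\circ u-bg\circ v$, where $w=lcm_\circ(a\bar f,b\bar g)=a\bar f\circ u=b\bar g\circ v$. For a set $S$ of monic polynomials and a monomial $w$, a polynomial $h$ is trivial modulo $(S,w)$ if $h=\sum_i\alpha_ia_is_i\circ u_i$ (finite sum) with $\alpha_i\in k$, $a_i\in[x]$, $u_i\in Rig[x]$, $s_i\in S$ and $a_i\overline{s_i}\circ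 u_i<w$ for all $i$. $S$ is a Gröbner-Shirshov basis in $kRig[x]$ if every composition $(f,g)_w$ with $f,g\in S$ is trivial modulo $(S,w)$. *)

theory Defs
  imports "HOL-Library.Poly_Mapping" "HOL-Computational_Algebra.Polynomial"
begin

text \<open>
  The free commutative semiring \<open>Rig[x]\<close> is \<open>\<nat>[x]\<close>, i.e. the type \<open>nat poly\<close>: the operation
  \<open>\<circ>\<close> is \<open>+\<close>, its neutral element \<open>\<theta>\<close> is \<open>0\<close>, and \<open>\<cdot>\<close> is \<open>*\<close>. The monomial
  \<open>u\<^sub>1 \<circ> \<dots> \<circ> u\<^sub>n\<close> is the polynomial in which the coefficient of \<open>x ^ i\<close> is the
  multiplicity of \<open>x ^ i\<close> among the \<open>u\<^sub>l\<close>.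
\<close>

type_synonym rig = "nat poly"

abbreviation genx :: rig where
  "genx \<equiv> monom 1 1"

definition wt :: "rig \<Rightarrow> nat list" where
  "wt u = concat (map (\<lambda>i. replicate (coeff u i) i) (rev [0..<Suc (degree u)]))"

text \<open>\<^const>\<open>lexord\<close> also puts a proper prefix below the longer list, as the ordering requires.\<close>

definition rig_less :: "rig \<Rightarrow> rig \<Rightarrow> bool" where
  "rig_less u v \<longleftrightarrow> (wt u, wt v) \<in> lexord {(m, n). m < n}"

text \<open>The common part \<open>c\<close> is \<open>w\<^sub>1 \<circ> \<dots> \<circ> w\<^sub>m\<close>; the remainders \<open>u'\<close>, \<open>v'\<close> share no power of \<open>x\<close>.\<close>

definition is_lcm_circ :: "rig \<Rightarrow> rig \<Rightarrow> rig \<Rightarrow> bool" where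
  "is_lcm_circ u v w \<longleftrightarrow>
     (\<exists>c u' v'. u = c + u' \<and> v = c + v' \<and>
        (\<forall>i. coeff u' i = 0 \<or> coeff v' i = 0) \<and> w = c + u' + v')"

text \<open>
  Elements of \<open>kRig[x]\<close> are finitely supported functions \<open>Rig[x] \<rightarrow> k\<close>. The multiplication
  that the library puts on this type is convolution along the addition of \<^typ>\<open>rig\<close>, so
  \<open>*\<close> on \<open>kRig[x]\<close> is the bilinear extension of \<open>\<circ>\<close>, with unit \<open>\<theta>\<close>. The bilinear extension of
  \<open>\<cdot>\<close> is defined separately. Note that \<open>\<theta>\<close> is a basis element, different from the zero vector.
\<close>

type_synonym 'k krig = "rig \<Rightarrow>\<^sub>0 'k"

abbreviation circ :: "'k::field krig \<Rightarrow> 'k krig \<Rightarrow> 'k krig" where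
  "circ f g \<equiv> f * g"

definition dot :: "'k::field krig \<Rightarrow> 'k krig \<Rightarrow> 'k krig" where
  "dot f g = (\<Sum>u\<in>Poly_Mapping.keys f. \<Sum>v\<in>Poly_Mapping.keys g.
     Poly_Mapping.single (u * v) (Poly_Mapping.lookup f u * Poly_Mapping.lookup g v))"

abbreviation scale :: "'k::field \<Rightarrow> 'k krig \<Rightarrow> 'k krig" where
  "scale c f \<equiv> Poly_Mapping.map ((*) c) f"

abbreviation basis :: "rig \<Rightarrow> 'k::field krig" where
  "basis u \<equiv> Poly_Mapping.single u 1"

definition rel :: "rig \<Rightarrow> rig \<Rightarrow> 'k::field krig" where
  "rel u v = basis u - basis v"

definition krig_ideal :: "'k::field krig set \<Rightarrow> bool" where
  "krig_ideal I \<longleftrightarrow>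
     0 \<in> I \<and> (\<forall>f\<in>I. \<forall>g\<in>I. f + g \<in> I) \<and> (\<forall>c. \<forall>f\<in>I. scale c f \<in> I) \<and>
     (\<forall>f\<in>I. \<forall>g. circ f g \<in> I) \<and> (\<forall>f\<in>I. \<forall>g. dot f g \<in> I)"

definition Id_gen :: "'k::field krig set \<Rightarrow> 'k krig set" where
  "Id_gen S = krig_ideal hull S"

text \<open>Meaningful for \<open>f \<noteq> 0\<close> only.\<close>

definition lead :: "'k::field krig \<Rightarrow> rig" where
  "lead f = (THE u. u \<in> Poly_Mapping.keys f \<and>
     (\<forall>v\<in>Poly_Mapping.keys f. v = u \<or> rig_less v u))"

definition monic :: "'k::field krig \<Rightarrow> bool" where
  "monic f \<longleftrightarrow> f \<noteq> 0 \<and> Poly_Mapping.lookup f (lead f) = 1"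

text \<open>
  \<open>m\<close> is the least common multiple of \<open>u\<close> and \<open>v\<close> in the monoid \<open>[x]\<close> of powers of \<open>x\<close>;
  among powers of \<open>x\<close>, divisibility in \<open>\<nat>[x]\<close> is divisibility in \<open>[x]\<close>.
\<close>

definition is_lcm_powers :: "rig \<Rightarrow> rig \<Rightarrow> rig \<Rightarrow> bool" where
  "is_lcm_powers u v m \<longleftrightarrow>
     m \<in> range ((^) genx) \<and> u dvd m \<and> v dvd m \<and>
     (\<forall>m'\<in>range ((^) genx). u dvd m' \<and> v dvd m' \<longrightarrow> m dvd m')"

text \<open>
  \<open>h\<close> is a composition \<open>(f, g)\<^sub>w\<close>. The factors \<open>u\<^sub>i = x ^ i\<close> of \<open>lead f\<close> and \<open>v\<^sub>j = x ^ j\<close> of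
  \<open>lead g\<close> are selected by exponent instead of position, since equal factors give equal
  compositions.
\<close>

definition is_composition ::
  "'k::field krig \<Rightarrow> 'k krig \<Rightarrow> rig \<Rightarrow> 'k krig \<Rightarrow> bool" where
  "is_composition f g w h \<longleftrightarrow>
     (\<exists>i j. coeff (lead f) i > 0 \<and> coeff (lead g) j > 0 \<and>
       (\<exists>a\<in>range ((^) genx). \<exists>b\<in>range ((^) genx). \<exists>u v.
          a * genx ^ i = b * genx ^ j \<and>
          is_lcm_powers (genx ^ i) (genx ^ j) (a * genx ^ i) \<and>
          is_lcm_circ (a * lead f) (b * lead g) w \<and>
          w = a * lead f + u \<and> w = b * lead g + v \<and>
          h = circ (dot (basis a) f) (basis u) - circ (dot (basis b) g) (basis v)))"

definition trivial_mod :: "'k::field krig set \<Rightarrow> rig \<Rightarrow> 'k krig \<Rightarrow> bool" where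
  "trivial_mod S w h \<longleftrightarrow>
     (\<exists>(n::nat) \<alpha> a s u.
        (\<forall>l<n. a l \<in> range ((^) genx) \<and> s l \<in> S \<and> rig_less (a l * lead (s l) + u l) w) \<and>
        h = (\<Sum>l<n. scale (\<alpha> l) (circ (dot (basis (a l)) (s l)) (basis (u l)))))"

definition groebner_shirshov_basis :: "'k::field krig set \<Rightarrow> bool" where
  "groebner_shirshov_basis S \<longleftrightarrow>
     (\<forall>s\<in>S. monic s) \<and>
     (\<forall>f\<in>S. \<forall>g\<in>S. \<forall>w h. is_composition f g w h \<longrightarrow> trivial_mod S w h)"

end

theory Submission
  imports Defs
begin

text \<open>
  Every composition of two relations of \<open>S\<close> is a binomial \<open>p - q\<close> in which \<open>p\<close> and \<open>q\<close> arise
  from the same monomial \<open>w\<close> by one rewriting step each, so that both lie below \<open>w\<close> and are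
  congruent. The compositions are therefore not examined one by one. Instead, \<open>S\<close> is shown to
  connect \<^emph>\<open>any\<close> two monomials below \<open>w\<close> that a certain invariant does not separate, by steps that
  stay below \<open>w\<close>.

  The invariant comes from a model of the quotient semiring. Modulo \<open>x = 1 + x\<^sup>2\<close> a monomial
  \<open>p \<in> \<nat>[x]\<close> still determines its value at a primitive sixth root of unity \<open>\<zeta>\<close>, and whether it is a
  constant: neither side of any relation is a constant, so no relation applies to one. All the
  rules preserve these two data (\<open>same_class_rewrite\<close>). Conversely, a monomial to which no rule
  applies is determined by them (\<open>normal_unique\<close>): the rules leave only
  \[ m + n x,\quad m x + n x^2,\quad m x^2 + n x^3,\quad m x^3 + n x^4,\quad m + n x^4,\quad
     m + x^3, \]
  and since \<open>\<zeta>\<^sup>i\<close> for \<open>i \<le> 4\<close> are five consecutive sixth roots of unity, the first five families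
  are the lattice points of five closed sectors that tile the plane and overlap only in their
  common rays. The last family, with \<open>m > 0\<close>, has the values \<open>m - 1\<close> of the constants, and is told
  apart from them by the second datum. Rewriting terminates because each rule decreases the value
  at \<open>2\<close>, and it goes down in the monomial ordering. So two monomials below \<open>w\<close> with the same
  invariant reduce, below \<open>w\<close>, to the same normal form (\<open>same_class_trivial\<close>).

  The equality of the two ideals is a computation in the semiring with \<open>x = 1 + x\<^sup>2\<close>. Each positive
  power of \<open>x\<close> absorbs \<open>1 + x\<^sup>3\<close>, because \<open>x + 1 + x\<^sup>3 = 1 + x\<^sup>2 = x\<close> and a higher power is the sum of
  its two neighbours. Hence \<open>x\<^sup>5 = x\<^sup>5 + 1 + x\<^sup>3 = 1 + x\<^sup>4\<close> (\<open>rules_in_ideal\<close>).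
\<close>

text \<open>
  The generator is \<^term>\<open>monom 1 1 :: rig\<close>. Unfolding \<open>1\<close> to \<open>Suc 0\<close> inside it would hide it from the
  lemmas stated for \<^term>\<open>genx\<close>.
\<close>

declare One_nat_def [simp del]

section \<open>The monomial ordering\<close>

text \<open>
  Two multisets of powers are compared by \<^const>\<open>rig_less\<close> at the highest power whose multiplicities
  differ. In this form compatibility with \<open>\<circ>\<close> and with multiplication by a power of \<open>x\<close> is evident.
\<close>

definition top_coeff_less :: "rig \<Rightarrow> rig \<Rightarrow> bool" where
  "top_coeff_less u v \<longleftrightarrow>
     (\<exists>d. coeff u d < coeff v d \<and> (\<forall>e>d. coeff u e = coeff v e))"

lemma wt_upto:
  assumes "degree u < n"
  shows "wt u = concat (map (\<lambda>i. replicate (coeff u i) i) (rev [0..<n]))"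
proof -
  have "[0..<n] = [0..<Suc (degree u)] @ [Suc (degree u)..<n]"
    using assms by (metis Suc_leI le_add_diff_inverse upt_add_eq_append zero_le)
  moreover have "concat (map (\<lambda>i. replicate (coeff u i) i) (rev [Suc (degree u)..<n])) = []"
    by (auto simp: coeff_eq_0)
  ultimately show ?thesis
    unfolding wt_def by simp
qed

text \<open>
  The blocks above the top difference \<open>d\<close> coincide and cancel. After cancelling the copies of \<open>d\<close>
  in \<open>u\<close> as well, \<open>v\<close> continues with another \<open>d\<close>, and \<open>u\<close> with something smaller or with nothing.
\<close>

lemma rig_less_if_top_coeff_less:
  assumes "top_coeff_less u v"
  shows "rig_less u v"
proof -
  from assms obtain d where d: "coeff u d < coeff v d" "\<And>e. e > d \<Longrightarrow> coeff u e = coeff v e"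
    unfolding top_coeff_less_def by blast
  \<comment> \<open>Padding with empty blocks up to a common bound aligns the two lists.\<close>
  define n where "n = Suc (max d (max (degree u) (degree v)))"
  define blk where "blk = (\<lambda>p i. replicate (coeff p i) (i::nat))"
  define hi where "hi = concat (map (blk v) (rev [Suc d..<n]))"
  define lo where "lo = (\<lambda>p. concat (map (blk p) (rev [0..<d])))"
  have split: "[0..<n] = [0..<d] @ d # [Suc d..<n]"
    by (metis n_def le_imp_less_Suc max.cobounded1 upt_add_eq_append upt_conv_Cons le_add_diff_inverse
        less_imp_le_nat zero_le)
  have hi_u: "concat (map (blk u) (rev [Suc d..<n])) = hi"
    unfolding hi_def blk_def using d(2) by (intro arg_cong[where f = concat] map_cong) auto
  have u: "wt u = hi @ replicate (coeff u d) d @ lo u"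
    using wt_upto[of u n] hi_u by (simp add: n_def[symmetric] split blk_def lo_def) (simp add: n_def)
  have v: "wt v = hi @ replicate (coeff v d) d @ lo v"
    using wt_upto[of v n] by (simp add: n_def[symmetric] split blk_def lo_def hi_def) (simp add: n_def)
  obtain m where m: "coeff v d = coeff u d + Suc m"
    using d(1) less_iff_Suc_add by auto
  have "set (lo u) \<subseteq> {..<d}"
    by (auto simp: lo_def blk_def)
  then have "(lo u, d # replicate m d @ lo v) \<in> lexord {(m, n). m < n}"
    by (cases "lo u") auto
  then have "(wt u, wt v) \<in> lexord {(m, n). m < n}"
    unfolding u v m replicate_add append_assoc by (auto intro!: lexord_append_leftI)
  then show ?thesis
    by (simp add: rig_less_def)
qed

lemma rig_less_trans: "rig_less u v \<Longrightarrow> rig_less v w \<Longrightarrow> rig_less u w"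
  unfolding rig_less_def by (erule lexord_trans) (auto intro: transI)

lemma rig_less_irrefl: "\<not> rig_less u u"
  unfolding rig_less_def by (rule lexord_irreflexive) auto

lemma coeff_shift: "coeff (genx ^ k * p) i = (if k \<le> i then coeff p (i - k) else 0)" for p :: rig
  by (simp add: monom_power coeff_monom_mult)

lemma top_coeff_less_shift_add:
  assumes "top_coeff_less r l"
  shows "top_coeff_less (genx ^ k * r + u) (genx ^ k * l + u)"
proof -
  from assms obtain d where "coeff r d < coeff l d" "\<And>e. e > d \<Longrightarrow> coeff r e = coeff l e"
    unfolding top_coeff_less_def by blast
  then show ?thesis
    unfolding top_coeff_less_def by (intro exI[of _ "d + k"]) (auto simp: coeff_shift)
qed

section \<open>Binomials\<close>

lemma keys_rel: "p \<noteq> q \<Longrightarrow> Poly_Mapping.keys (rel p q :: 'k::field krig) = {p, q}"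
  by (auto simp: rel_def in_keys_iff lookup_minus lookup_single when_def split: if_splits)

lemma rel_self: "rel p p = 0"
  by (simp add: rel_def)

lemma rel_trans: "rel p q + rel q r = rel p r"
  by (simp add: rel_def)

lemma dot_rel_basis: "dot (rel p q) (basis a) = (rel (p * a) (q * a) :: 'k::field krig)"
proof (cases "p = q")
  case False
  then show ?thesis
    by (simp add: dot_def keys_rel)
      (simp add: rel_def lookup_minus lookup_single when_def single_uminus)
qed (simp add: rel_self dot_def)

lemma dot_basis_rel: "dot (basis a) (rel p q) = (rel (a * p) (a * q) :: 'k::field krig)"
proof (cases "p = q")
  case False
  then show ?thesis
    by (simp add: dot_def keys_rel)
      (simp add: rel_def lookup_minus lookup_single when_def single_uminus)
qed (simp add: rel_self dot_def)

lemma circ_rel_basis: "circ (rel p q) (basis u) = (rel (p + u) (q + u) :: 'k::field krig)"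
  by (simp add: rel_def left_diff_distrib mult_single)

lemma scale_one: "scale 1 f = (f :: 'k::field krig)"
  by (rule poly_mapping_eqI) (simp add: Poly_Mapping.map.rep_eq when_def)

lemma scale_minus_one: "scale (- 1) f = - (f :: 'k::field krig)"
  by (rule poly_mapping_eqI) (simp add: Poly_Mapping.map.rep_eq when_def)

lemma lead_rel:
  assumes "rig_less r l"
  shows "lead (rel l r :: 'k::field krig) = l"
proof -
  have ne: "l \<noteq> r"
    using assms rig_less_irrefl by blast
  show ?thesis
    unfolding lead_def keys_rel[OF ne] using assms rig_less_trans[of l r l] rig_less_irrefl
    by (intro the_equality) auto
qed

lemma monic_rel:
  assumes "rig_less r l"
  shows "monic (rel l r :: 'k::field krig)"
proof -
  have ne: "l \<noteq> r"
    using assms rig_less_irrefl by blast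
  then have "Poly_Mapping.lookup (rel l r :: 'k krig) l = 1"
    by (simp add: rel_def lookup_minus lookup_single when_def)
  then show ?thesis
    unfolding monic_def lead_rel[OF assms] by auto
qed

section \<open>Polynomials that are trivial modulo a set\<close>

lemma trivial_mod_zero: "trivial_mod S w 0"
  unfolding trivial_mod_def by (rule exI[of _ 0]) simp

lemma trivial_mod_add:
  assumes "trivial_mod S w g" "trivial_mod S w h"
  shows "trivial_mod S w (g + h)"
proof -
  define summand where "summand = (\<lambda>\<alpha> a s u. scale \<alpha> (circ (dot (basis a) s) (basis u)) :: 'a krig)"
  from assms(1) obtain m \<alpha> a s u where 1:
    "\<And>l. l < (m::nat) \<Longrightarrow> a l \<in> range ((^) genx) \<and> s l \<in> S \<and> rig_less (a l * lead (s l) + u l) w"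
    "g = (\<Sum>l<m. summand (\<alpha> l) (a l) (s l) (u l))"
    unfolding trivial_mod_def summand_def by blast
  from assms(2) obtain n \<beta> b t v where 2:
    "\<And>l. l < (n::nat) \<Longrightarrow> b l \<in> range ((^) genx) \<and> t l \<in> S \<and> rig_less (b l * lead (t l) + v l) w"
    "h = (\<Sum>l<n. summand (\<beta> l) (b l) (t l) (v l))"
    unfolding trivial_mod_def summand_def by blast
  define A where "A = (\<lambda>l. if l < m then a l else b (l - m))"
  define C where "C = (\<lambda>l. if l < m then \<alpha> l else \<beta> (l - m))"
  define T where "T = (\<lambda>l. if l < m then s l else t (l - m))"
  define U where "U = (\<lambda>l. if l < m then u l else v (l - m))"
  have "(\<Sum>l<m + n. summand (C l) (A l) (T l) (U l)) =
      (\<Sum>l<m. summand (C l) (A l) (T l) (U l)) + (\<Sum>l<n. summand (C (m + l)) (A (m + l)) (T (m + l)) (U (m + l)))"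
    by (induction n) (simp_all add: add.assoc)
  also have "\<dots> = g + h"
    by (simp add: 1 2 A_def C_def T_def U_def)
  finally have "g + h = (\<Sum>l<m + n. summand (C l) (A l) (T l) (U l))" ..
  moreover have "A l \<in> range ((^) genx) \<and> T l \<in> S \<and> rig_less (A l * lead (T l) + U l) w"
    if "l < m + n" for l
    using 1(1)[of l] 2(1)[of "l - m"] that by (auto simp: A_def T_def U_def)
  ultimately show ?thesis
    unfolding trivial_mod_def summand_def by blast
qed

lemma trivial_mod_single:
  assumes "s \<in> S" "rig_less (genx ^ k * lead s + u) w"
  shows "trivial_mod S w (scale c (circ (dot (basis (genx ^ k)) s) (basis u)))"
  unfolding trivial_mod_def
  by (rule exI[of _ 1], rule exI[of _ "\<lambda>_. c"], rule exI[of _ "\<lambda>_. genx ^ k"],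
      rule exI[of _ "\<lambda>_. s"], rule exI[of _ "\<lambda>_. u"]) (use assms in simp)

section \<open>The rewriting system\<close>

text \<open>
  The relations, oriented from the leading monomial to the smaller one. The fourth relation
  is listed for \<open>n = 3\<close> and for \<open>n = 4\<close>.
\<close>

definition rules :: "(rig \<times> rig) set" where
  "rules = {(1 + genx ^ 2, genx), (genx + genx ^ 4, 1 + genx ^ 3), (genx ^ 5, 1 + genx ^ 4),
            (1 + genx ^ 3 + genx ^ 3, genx ^ 3), (1 + genx ^ 3 + genx ^ 4, genx ^ 4)}"

lemma coeff_genx_power: "coeff (genx ^ n :: rig) i = (if i = n then 1 else 0)"
  by (simp add: monom_power)

lemma rules_decreasing:
  assumes "(l, r) \<in> rules"
  shows "top_coeff_less r l"
  using assms unfolding rules_def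
  apply (elim insertE emptyE; clarsimp)
  unfolding top_coeff_less_def
  \<comment> \<open>The witnesses are the highest powers at which the two sides differ.\<close>
  subgoal by (rule exI[of _ 2]) (simp add: coeff_genx_power)
  subgoal by (rule exI[of _ 4]) (simp add: coeff_genx_power)
  subgoal by (rule exI[of _ 5]) (simp add: coeff_genx_power)
  subgoal by (rule exI[of _ 3]) (simp add: coeff_genx_power)
  subgoal by (rule exI[of _ 3]) (simp add: coeff_genx_power)
  done

text \<open>
  The value at \<open>2\<close> is a termination measure in \<open>\<nat>\<close>, used in place of the well-foundedness of the
  monomial ordering. Any integer \<open>t \<ge> 2\<close> would do: all that matters is \<open>1 + t\<^sup>2 > t\<close>, \<open>t + t\<^sup>4 > 1 + t\<^sup>3\<close>
  and \<open>t\<^sup>5 > 1 + t\<^sup>4\<close>.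
\<close>

lemma rules_decrease_at_2:
  assumes "(l, r) \<in> rules"
  shows "poly r 2 < poly l 2"
  using assms by (auto simp: rules_def poly_monom)

section \<open>Invariants of the congruence\<close>

text \<open>
  With \<open>\<zeta>\<^sup>2 = \<zeta> - 1\<close>, the integer \<open>zeta_coord n\<close> is the coordinate of \<open>\<zeta>\<^sup>n\<close> at \<open>1\<close> in the basis
  \<open>1, \<zeta>\<close> of \<open>\<int>[\<zeta>]\<close>.
\<close>

fun zeta_coord :: "nat \<Rightarrow> int" where
  "zeta_coord 0 = 1"
| "zeta_coord (Suc 0) = 0"
| "zeta_coord (Suc (Suc n)) = zeta_coord (Suc n) - zeta_coord n"

text \<open>
  The coordinate at \<open>1\<close> of \<open>\<zeta>\<^sup>k p(\<zeta>)\<close>. The coordinate of \<open>p(\<zeta>)\<close> at \<open>\<zeta>\<close> is the negative of the case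
  \<open>k = 1\<close>. With the shift \<open>k\<close> as a parameter, a single integer-valued functional describes the
  value at \<open>\<zeta>\<close> and also its behaviour under multiplication by powers of \<open>x\<close>.
\<close>

definition value_coord :: "nat \<Rightarrow> rig \<Rightarrow> int" where
  "value_coord k p = (\<Sum>i\<le>degree p. int (coeff p i) * zeta_coord (i + k))"

lemma value_coord_upto:
  assumes "degree p \<le> n"
  shows "value_coord k p = (\<Sum>i\<le>n. int (coeff p i) * zeta_coord (i + k))"
  unfolding value_coord_def using assms
  by (intro sum.mono_neutral_left) (auto simp: coeff_eq_0)

lemma value_coord_add: "value_coord k (p + q) = value_coord k p + value_coord k q"
proof -
  define n where "n = max (degree p) (degree q)"
  have "degree (p + q) \<le> n" "degree p \<le> n" "degree q \<le> n"
    using degree_add_le_max[of p q] by (auto simp: n_def)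
  then show ?thesis
    by (simp add: value_coord_upto[of _ n] sum.distrib algebra_simps)
qed

lemma value_coord_shift: "value_coord k (genx ^ j * p) = value_coord (k + j) p"
proof -
  have "degree (genx ^ j * p) \<le> j + degree p"
    by (rule degree_le) (auto simp: coeff_shift coeff_eq_0)
  then have "value_coord k (genx ^ j * p)
      = (\<Sum>i\<le>j + degree p. int (coeff (genx ^ j * p) i) * zeta_coord (i + k))"
    by (rule value_coord_upto)
  \<comment> \<open>The terms below \<open>j\<close> vanish; the others are reindexed by \<open>i \<mapsto> j + i\<close>.\<close>
  also have "\<dots> = (\<Sum>i\<in>(+) j ` {..degree p}. int (coeff (genx ^ j * p) i) * zeta_coord (i + k))"
  proof (intro sum.mono_neutral_right ballI)
    fix i assume i: "i \<in> {..j + degree p} - (+) j ` {..degree p}"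
    have "i < j"
    proof (rule ccontr)
      assume "\<not> i < j"
      with i have "i = j + (i - j)" "i - j \<le> degree p" by auto
      with i show False by blast
    qed
    then show "int (coeff (genx ^ j * p) i) * zeta_coord (i + k) = 0"
      by (simp add: coeff_shift)
  qed auto
  also have "\<dots> = value_coord (k + j) p"
    by (subst sum.reindex) (auto simp: value_coord_def coeff_shift add_ac)
  finally show ?thesis .
qed

lemma value_coord_one: "value_coord k 1 = zeta_coord k"
  by (simp add: value_coord_def)

lemma value_coord_genx_power: "value_coord k (genx ^ n) = zeta_coord (k + n)"
  using value_coord_shift[of k n 1] by (simp add: value_coord_one)

definition nonconst :: "rig \<Rightarrow> bool" where
  "nonconst p \<longleftrightarrow> (\<exists>i>0. coeff p i > 0)"

definition same_class :: "rig \<Rightarrow> rig \<Rightarrow> bool" where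
  "same_class p q \<longleftrightarrow> (\<forall>k. value_coord k p = value_coord k q) \<and> (nonconst p \<longleftrightarrow> nonconst q)"

text \<open>The second equation is \<open>\<zeta>\<^sup>3 = -1\<close>; the last two are its consequences.\<close>

lemma zeta_coord_shift:
  "zeta_coord (k + 2) = zeta_coord (Suc k) - zeta_coord k"
  "zeta_coord (k + 3) = - zeta_coord k"
  "zeta_coord (k + 4) = - zeta_coord (Suc k)"
  "zeta_coord (k + 5) = - zeta_coord (k + 2)"
  by (simp_all add: eval_nat_numeral One_nat_def)

lemma rules_value_coord:
  assumes "(l, r) \<in> rules"
  shows "value_coord k l = value_coord k r"
proof -
  have g: "value_coord k genx = zeta_coord (Suc k)"
    using value_coord_genx_power[of k 1] by (simp add: One_nat_def)
  show ?thesis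
    using assms unfolding rules_def
    by (elim insertE emptyE; clarsimp simp: value_coord_add value_coord_genx_power
        value_coord_one g zeta_coord_shift)
qed

lemma nonconst_add: "nonconst (p + q) \<longleftrightarrow> nonconst p \<or> nonconst q"
  by (auto simp: nonconst_def)

lemma nonconst_genx_power: "n > 0 \<Longrightarrow> nonconst (genx ^ n)"
  by (auto simp: nonconst_def coeff_genx_power)

lemma rules_nonconst:
  assumes "(l, r) \<in> rules"
  shows "nonconst l" "nonconst r"
  using assms nonconst_genx_power[of 1]
  by (auto simp: rules_def nonconst_add nonconst_genx_power)

lemma same_class_rewrite:
  assumes "(l, r) \<in> rules"
  shows "same_class (genx ^ k * l + u) (genx ^ k * r + u)"
proof -
  have nc: "nonconst (genx ^ k * p + u)" if "nonconst p" for p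
  proof -
    from that obtain i where "i > 0" "coeff p i > 0"
      by (auto simp: nonconst_def)
    then show ?thesis
      unfolding nonconst_def by (intro exI[of _ "i + k"]) (auto simp: coeff_shift)
  qed
  show ?thesis
    using rules_value_coord[OF assms] nc rules_nonconst[OF assms]
    by (simp add: same_class_def value_coord_add value_coord_shift)
qed

section \<open>Normal forms\<close>

definition normal :: "rig \<Rightarrow> bool" where
  "normal p \<longleftrightarrow> \<not> (\<exists>l r k u. (l, r) \<in> rules \<and> p = genx ^ k * l + u)"

text \<open>
  If \<open>x\<^sup>k \<cdot> l\<close> were contained in \<open>p\<close> coefficientwise, the difference would be a monomial \<open>u\<close> with
  \<open>p = x\<^sup>k \<cdot> l \<circ> u\<close>, and the rule would apply.
\<close>

lemma normal_coeff:
  assumes "normal p" "(l, r) \<in> rules"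
  shows "\<exists>i. coeff p (i + k) < coeff l i"
proof (rule ccontr)
  assume "\<not> ?thesis"
  then have le: "coeff l i \<le> coeff p (i + k)" for i
    by (simp add: not_less)
  have "p = genx ^ k * l + (p - genx ^ k * l)"
  proof (rule poly_eqI)
    fix i
    show "coeff p i = coeff (genx ^ k * l + (p - genx ^ k * l)) i"
      using le[of "i - k"] by (cases "k \<le> i") (simp_all add: coeff_shift)
  qed
  with assms show False
    unfolding normal_def by blast
qed

lemma normal_cases:
  assumes "normal p"
  shows "j = i + 2 \<Longrightarrow> coeff p i = 0 \<or> coeff p j = 0"
    and "coeff p 1 = 0 \<or> coeff p 4 = 0"
    and "i \<ge> 5 \<Longrightarrow> coeff p i = 0"
    and "coeff p 0 = 0 \<or> coeff p 3 \<le> 1"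
    and "coeff p 0 = 0 \<or> coeff p 3 = 0 \<or> coeff p 4 = 0"
proof -
  note nc = normal_coeff[OF assms]
  note simps = coeff_genx_power of_bool_def
  have "(1 + genx ^ 2, genx) \<in> rules"
    by (simp add: rules_def)
  from nc[OF this, of i] obtain m where m: "coeff p (m + i) < coeff (1 + genx ^ 2) m" ..
  then have "m = 0 \<or> m = 2"
    by (auto simp: simps split: if_splits)
  with m show "coeff p i = 0 \<or> coeff p j = 0" if "j = i + 2"
    unfolding that by (auto simp: simps add.commute[of 2])
  have "(genx + genx ^ 4, 1 + genx ^ 3) \<in> rules"
    by (simp add: rules_def)
  from nc[OF this, of 0] show "coeff p 1 = 0 \<or> coeff p 4 = 0"
    by (auto simp: simps split: if_splits)
  have "(genx ^ 5, 1 + genx ^ 4) \<in> rules"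
    by (simp add: rules_def)
  from nc[OF this, of "i - 5"] show "coeff p i = 0" if "i \<ge> 5"
    using that by (auto simp: simps split: if_splits)
  have "(1 + genx ^ 3 + genx ^ 3, genx ^ 3) \<in> rules"
    by (simp add: rules_def)
  from nc[OF this, of 0] show "coeff p 0 = 0 \<or> coeff p 3 \<le> 1"
    by (auto simp: simps split: if_splits)
  have "(1 + genx ^ 3 + genx ^ 4, genx ^ 4) \<in> rules"
    by (simp add: rules_def)
  from nc[OF this, of 0] show "coeff p 0 = 0 \<or> coeff p 3 = 0 \<or> coeff p 4 = 0"
    by (auto simp: simps split: if_splits)
qed

lemma normal_values:
  assumes "normal p"
  shows "value_coord 0 p = int (coeff p 0) - int (coeff p 2) - int (coeff p 3)"
    and "value_coord 1 p = int (coeff p 4) - int (coeff p 1) - int (coeff p 2)"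
    and "nonconst p \<longleftrightarrow> coeff p 1 + coeff p 2 + coeff p 3 + coeff p 4 > 0"
proof -
  have "degree p \<le> 4"
    using normal_cases(3)[OF assms] by (intro degree_le) auto
  note v = value_coord_upto[OF this]
  have coords: "zeta_coord 1 = 0" "zeta_coord 2 = -1" "zeta_coord 3 = -1" "zeta_coord 4 = 0" "zeta_coord 5 = 1"
    using zeta_coord_shift[of 0, unfolded add_0 zeta_coord.simps] by (simp_all add: One_nat_def)
  have atMost_4: "{..4::nat} = {0, 1, 2, 3, 4}"
    by auto
  show "value_coord 0 p = int (coeff p 0) - int (coeff p 2) - int (coeff p 3)"
    "value_coord 1 p = int (coeff p 4) - int (coeff p 1) - int (coeff p 2)"
    unfolding v atMost_4 by (simp_all add: coords)
  have "i = 1 \<or> i = 2 \<or> i = 3 \<or> i = 4" if "i > 0" "coeff p i > 0" for i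
  proof -
    have "\<not> i \<ge> 5"
      using normal_cases(3)[OF assms, of i] that(2) by linarith
    then show ?thesis
      using that(1) by linarith
  qed
  then have "nonconst p \<longleftrightarrow> (\<exists>i\<in>{1, 2, 3, 4}. coeff p i > 0)"
    unfolding nonconst_def by (metis insert_iff empty_iff zero_less_one zero_less_numeral)
  also have "\<dots> \<longleftrightarrow> coeff p 1 + coeff p 2 + coeff p 3 + coeff p 4 > 0"
    by (simp add: disj_assoc)
  finally show "nonconst p \<longleftrightarrow> coeff p 1 + coeff p 2 + coeff p 3 + coeff p 4 > 0" .
qed

text \<open>
  Here the value at \<open>\<zeta>\<close> is located in one of the sectors. Its coordinate \<open>B\<close> at \<open>\<zeta>\<close>, which is
  \<open>- value_coord 1 p\<close>, receives positive contributions from \<open>x\<close> and \<open>x\<^sup>2\<close> and negative ones from \<open>x\<^sup>4\<close>.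
  A normal form does not contain \<open>x\<^sup>4\<close> together with \<open>x\<close> or \<open>x\<^sup>2\<close>, so the sign of \<open>B\<close> decides. The power
  \<open>x\<^sup>2\<close> occurs only in the two sectors next to \<open>\<zeta>\<^sup>2 = -1 + \<zeta>\<close>, and there its coefficient is the smaller
  of \<open>B\<close> and the negated coordinate at \<open>1\<close>.
\<close>

lemma normal_coeff_values:
  assumes "normal p"
  shows "int (coeff p 4) = max (value_coord 1 p) 0"
    and "int (coeff p 1) + int (coeff p 2) = max (- value_coord 1 p) 0"
    and "int (coeff p 2) = max 0 (min (- value_coord 0 p) (- value_coord 1 p))"
proof -
  have c02: "coeff p 0 = 0 \<or> coeff p 2 = 0" and c13: "coeff p 1 = 0 \<or> coeff p 3 = 0"
    and c24: "coeff p 2 = 0 \<or> coeff p 4 = 0" and c14: "coeff p 1 = 0 \<or> coeff p 4 = 0"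
    using normal_cases(1)[OF assms, of 2 0] normal_cases(1)[OF assms, of 3 1]
      normal_cases(1)[OF assms, of 4 2] normal_cases(2)[OF assms] by simp_all
  obtain A B where v: "int (coeff p 0) - int (coeff p 2) - int (coeff p 3) = A"
      "int (coeff p 4) - int (coeff p 1) - int (coeff p 2) = B"
    and AB: "value_coord 0 p = A" "value_coord 1 p = B"
    using normal_values(1,2)[OF assms] by simp
  show "int (coeff p 4) = max (value_coord 1 p) 0"
    "int (coeff p 1) + int (coeff p 2) = max (- value_coord 1 p) 0"
    unfolding AB using c24 c14 v(2) by auto
  show "int (coeff p 2) = max 0 (min (- value_coord 0 p) (- value_coord 1 p))"
    unfolding AB using c02 c13 c24 v by (elim disjE; simp; linarith)
qed

text \<open>
  Since \<open>\<zeta>\<^sup>3 = -1\<close>, the value determines only the difference of the coefficients of \<open>1\<close> and \<open>x\<^sup>3\<close>.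
  Two normal forms that still differ must be \<open>m\<close> and \<open>(m + 1) + x\<^sup>3\<close> for some \<open>m\<close>, and only the first
  of these is a constant.
\<close>

lemma normal_unique:
  assumes "normal p" "normal q" "same_class p q"
  shows "p = q"
proof -
  have eq: "value_coord 0 p = value_coord 0 q" "value_coord 1 p = value_coord 1 q"
    "nonconst p \<longleftrightarrow> nonconst q"
    using assms(3) by (auto simp: same_class_def)
  have c124: "coeff p 1 = coeff q 1" "coeff p 2 = coeff q 2" "coeff p 4 = coeff q 4"
    using normal_coeff_values[OF assms(1)] normal_coeff_values[OF assms(2)] eq by simp_all
  have not_less: "\<not> coeff p 3 < coeff q 3"
    if "normal p" "normal q" and nc: "nonconst p \<longleftrightarrow> nonconst q"
      and e: "value_coord 0 p = value_coord 0 q"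
      and c: "coeff p 1 = coeff q 1" "coeff p 2 = coeff q 2" "coeff p 4 = coeff q 4" for p q
  proof
    assume less: "coeff p 3 < coeff q 3"
    then have pos: "coeff q 0 > 0"
      using e c unfolding normal_values(1)[OF that(1)] normal_values(1)[OF that(2)] by linarith
    then have "coeff q 1 = 0" "coeff q 2 = 0" "coeff q 4 = 0" "coeff p 3 = 0"
      using normal_cases(1)[OF that(2), of 2 0] normal_cases(1)[OF that(2), of 3 1]
        normal_cases(4,5)[OF that(2)] less by auto
    then show False
      using nc c less unfolding normal_values(3)[OF that(1)] normal_values(3)[OF that(2)] by simp
  qed
  have c3: "coeff p 3 = coeff q 3"
    using not_less[OF assms(1,2) eq(3,1)] not_less[OF assms(2,1) eq(3,1)[symmetric]] c124 by simp
  have c0: "coeff p 0 = coeff q 0"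
    using eq(1) c124 c3 unfolding normal_values(1)[OF assms(1)] normal_values(1)[OF assms(2)] by simp
  show ?thesis
  proof (rule poly_eqI)
    fix i :: nat
    have "i \<in> {0, 1, 2, 3, 4} \<or> i \<ge> 5"
      by auto
    then show "coeff p i = coeff q i"
      using c0 c124 c3 normal_cases(3)[OF assms(1), of i] normal_cases(3)[OF assms(2), of i] by auto
  qed
qed

section \<open>Compositions\<close>

definition rule_rels :: "'k::field krig set" where
  "rule_rels = (\<lambda>(l, r). rel l r) ` rules"

lemma rewrite_trivial:
  assumes "(l, r) \<in> rules" "rig_less (genx ^ k * l + u) w"
  shows "trivial_mod (rule_rels :: 'k::field krig set) w (rel (genx ^ k * l + u) (genx ^ k * r + u))"
    and "trivial_mod (rule_rels :: 'k::field krig set) w (rel (genx ^ k * r + u) (genx ^ k * l + u))"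
proof -
  have lr: "rig_less r l"
    by (rule rig_less_if_top_coeff_less[OF rules_decreasing[OF assms(1)]])
  have "(rel l r :: 'k krig) \<in> rule_rels"
    using assms(1) by (force simp: rule_rels_def)
  from trivial_mod_single[OF this, of k u w] assms(2)
  have t: "trivial_mod (rule_rels :: 'k krig set) w (scale c (rel (genx ^ k * l + u) (genx ^ k * r + u)))" for c
    by (simp add: lead_rel[OF lr] dot_basis_rel circ_rel_basis)
  show "trivial_mod (rule_rels :: 'k krig set) w (rel (genx ^ k * l + u) (genx ^ k * r + u))"
    using t[of 1] unfolding scale_one .
  show "trivial_mod (rule_rels :: 'k krig set) w (rel (genx ^ k * r + u) (genx ^ k * l + u))"
    using t[of "-1"] unfolding scale_minus_one by (simp add: rel_def)
qed

text \<open>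
  Each step \<open>p \<rightarrow> p'\<close> is licensed by \<open>p < w\<close>, and \<open>p' < p\<close> keeps the rest of the chain below \<open>w\<close>.
\<close>

lemma reduces_to_normal:
  assumes "rig_less p w"
  shows "\<exists>q. normal q \<and> same_class p q \<and>
    trivial_mod (rule_rels :: 'k::field krig set) w (rel p q) \<and> trivial_mod (rule_rels :: 'k krig set) w (rel q p)"
  using assms
proof (induction "poly p 2" arbitrary: p rule: less_induct)
  case less
  show ?case
  proof (cases "normal p")
    case True
    then show ?thesis
      by (intro exI[of _ p]) (simp add: same_class_def rel_self trivial_mod_zero)
  next
    case False
    then obtain l r k u where lr: "(l, r) \<in> rules" and p: "p = genx ^ k * l + u"
      unfolding normal_def by blast
    define p' where "p' = genx ^ k * r + u"
    have dec: "rig_less p' p"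
      unfolding p p'_def
      by (intro rig_less_if_top_coeff_less top_coeff_less_shift_add rules_decreasing[OF lr])
    have "poly p' 2 < poly p 2"
      using rules_decrease_at_2[OF lr] by (simp add: p p'_def poly_monom)
    from less.hyps[OF this rig_less_trans[OF dec less.prems]] obtain q where q: "normal q"
      "same_class p' q" "trivial_mod (rule_rels :: 'k krig set) w (rel p' q)"
      "trivial_mod (rule_rels :: 'k krig set) w (rel q p')"
      by blast
    have "same_class p q"
      using same_class_rewrite[OF lr, of k u] q(2) by (simp add: same_class_def p p'_def)
    moreover have "trivial_mod (rule_rels :: 'k krig set) w (rel p q)"
      using trivial_mod_add[OF rewrite_trivial(1)[OF lr, of k u w] q(3)] less.prems
      by (simp add: p p'_def rel_trans)
    moreover have "trivial_mod (rule_rels :: 'k krig set) w (rel q p)"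
      using trivial_mod_add[OF q(4), of "rel p' p"] rewrite_trivial(2)[OF lr, of k u w] less.prems
      by (simp add: p p'_def rel_trans)
    ultimately show ?thesis
      using q(1) by blast
  qed
qed

lemma same_class_trivial:
  assumes "rig_less p w" "rig_less q w" "same_class p q"
  shows "trivial_mod rule_rels w (rel p q)"
proof -
  obtain p' where p': "normal p'" "same_class p p'" "trivial_mod (rule_rels :: 'a krig set) w (rel p p')"
    using reduces_to_normal[OF assms(1)] by blast
  obtain q' where q': "normal q'" "same_class q q'" "trivial_mod (rule_rels :: 'a krig set) w (rel q' q)"
    using reduces_to_normal[OF assms(2)] by blast
  have "p' = q'"
    using assms(3) p'(2) q'(2) by (intro normal_unique p'(1) q'(1)) (auto simp: same_class_def)
  then show ?thesis
    using trivial_mod_add[OF p'(3) q'(3)] by (simp add: rel_trans)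
qed

text \<open>
  The leading terms of a composition cancel in \<open>w\<close>, which leaves the two results of rewriting \<open>w\<close>
  with the two rules. Both are below \<open>w\<close> and in its class.
\<close>

lemma composition_trivial:
  assumes f: "f \<in> rule_rels" and g: "g \<in> rule_rels" and comp: "is_composition f g w h"
  shows "trivial_mod rule_rels w h"
proof -
  from f obtain l1 r1 where 1: "(l1, r1) \<in> rules" "f = rel l1 r1"
    by (auto simp: rule_rels_def)
  from g obtain l2 r2 where 2: "(l2, r2) \<in> rules" "g = rel l2 r2"
    by (auto simp: rule_rels_def)
  have lead: "lead f = l1" "lead g = l2"
    unfolding 1 2 by (intro lead_rel rig_less_if_top_coeff_less rules_decreasing 1 2)+
  from comp obtain i j u v where w: "w = genx ^ i * l1 + u" "w = genx ^ j * l2 + v"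
    and h: "h = circ (dot (basis (genx ^ i)) f) (basis u) - circ (dot (basis (genx ^ j)) g) (basis v)"
    unfolding is_composition_def lead by blast
  define p where "p = genx ^ i * r1 + u"
  define q where "q = genx ^ j * r2 + v"
  have "h = rel w p - rel w q"
    unfolding h 1 2 dot_basis_rel circ_rel_basis p_def q_def using w by simp
  then have "h = rel q p"
    by (simp add: rel_def)
  moreover have "rig_less q w" "rig_less p w"
    unfolding p_def q_def
    by (simp only: w(2), intro rig_less_if_top_coeff_less top_coeff_less_shift_add rules_decreasing 2)
      (simp only: w(1), intro rig_less_if_top_coeff_less top_coeff_less_shift_add rules_decreasing 1)
  moreover have "same_class w p" "same_class w q"
    unfolding p_def q_def
    by (simp only: w(1), rule same_class_rewrite[OF 1(1)])
      (simp only: w(2), rule same_class_rewrite[OF 2(1)])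
  ultimately show ?thesis
    by (auto intro!: same_class_trivial simp: same_class_def)
qed

section \<open>The ideal of the defining relation\<close>

lemma krig_ideal_Id_gen: "krig_ideal (Id_gen S)"
  unfolding Id_gen_def
proof (rule hull_in)
  fix T :: "'a krig set set"
  assume T: "\<forall>I\<in>T. krig_ideal I"
  show "krig_ideal (\<Inter>T)"
    unfolding krig_ideal_def
  proof (intro conjI ballI allI InterI)
    fix I assume "I \<in> T"
    with T have I: "krig_ideal I"
      by simp
    show "0 \<in> I"
      using I by (simp add: krig_ideal_def)
    fix f g c assume f: "f \<in> \<Inter>T"
    with \<open>I \<in> T\<close> have f: "f \<in> I"
      by simp
    show "circ f g \<in> I" "dot f g \<in> I" "scale c f \<in> I"
      using I f by (simp_all add: krig_ideal_def)
    assume "g \<in> \<Inter>T"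
    with \<open>I \<in> T\<close> have "g \<in> I"
      by simp
    then show "f + g \<in> I"
      using I f by (simp add: krig_ideal_def)
  qed
qed

lemma rel_ideal_sym:
  assumes "krig_ideal I" "rel p q \<in> I"
  shows "rel q p \<in> I"
proof -
  have "scale (-1) (rel p q) \<in> I"
    using assms by (simp add: krig_ideal_def)
  also have "scale (-1) (rel p q) = rel q p"
    by (simp add: scale_minus_one rel_def)
  finally show ?thesis .
qed

lemma rel_ideal_trans:
  assumes "krig_ideal I" "rel p q \<in> I" "rel q r \<in> I"
  shows "rel p r \<in> I"
proof -
  have "rel p q + rel q r \<in> I"
    using assms by (simp add: krig_ideal_def)
  then show ?thesis
    by (simp only: rel_trans)
qed

lemma rel_ideal_mult_add:
  assumes "krig_ideal I" "rel p q \<in> I"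
  shows "rel (p * a + u) (q * a + u) \<in> I"
proof -
  have "circ (dot (rel p q) (basis a)) (basis u) \<in> I"
    using assms by (simp add: krig_ideal_def)
  then show ?thesis
    by (simp only: dot_rel_basis circ_rel_basis)
qed

text \<open>
  Any power of \<open>x\<close> with positive exponent is interchangeable with the sum of its two neighbours
  (\<open>split\<close>), and this alone yields all the rules.
\<close>

lemma rules_in_ideal:
  assumes ideal: "krig_ideal I" and base: "rel (1 + genx ^ 2) genx \<in> I" and rule: "(l, r) \<in> rules"
  shows "rel l r \<in> I"
proof -
  note trans = rel_ideal_trans[OF ideal] and sym = rel_ideal_sym[OF ideal]
  define x :: rig where "x = genx"
  have split: "rel (x ^ i + x ^ k + u) (x ^ j + u) \<in> I" if "j = i + 1" "k = i + 2" for i j k u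
  proof -
    have "(1 + x ^ 2) * x ^ i = x ^ i + x ^ k"
      unfolding that by (simp only: distrib_right mult_1_left power_add[symmetric] add.commute)
    moreover have "x * x ^ i = x ^ j"
      unfolding that by (simp only: Suc_eq_plus1[symmetric] power_Suc)
    ultimately show ?thesis
      using rel_ideal_mult_add[OF ideal base, of "x ^ i" u] by (simp only: x_def)
  qed
  have "rel (x + x ^ 4) (1 + x ^ 2 + x ^ 4) \<in> I"
    using sym[OF split[of 1 0 2 "x ^ 4"]] by simp
  moreover have "rel (1 + x ^ 2 + x ^ 4) (1 + x ^ 3) \<in> I"
    using split[of 3 2 4 1] by (simp add: add_ac)
  ultimately have shift: "rel (x + x ^ 4) (1 + x ^ 3) \<in> I"
    by (rule trans)
  have absorb: "rel (1 + x ^ 3 + x ^ m) (x ^ m) \<in> I" if "m \<ge> 1" for m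
    using that
  proof (induction m rule: dec_induct)
    case base
    have "rel (1 + x ^ 3 + x ^ 1) (1 + x ^ 2) \<in> I"
      using split[of 2 1 3 1] by (simp add: add_ac)
    moreover have "rel (1 + x ^ 2) (x ^ 1) \<in> I"
      using split[of 1 0 2 0] by simp
    ultimately show ?case
      by (rule trans)
  next
    case (step m)
    have "rel (1 + x ^ 3 + x ^ Suc m) (1 + x ^ 3 + x ^ m + x ^ (m + 2)) \<in> I"
      using sym[OF split[of "Suc m" m "m + 2" "1 + x ^ 3"]] by (simp add: add_ac del: power_Suc add_2_eq_Suc')
    moreover have "rel (1 + x ^ 3 + x ^ m + x ^ (m + 2)) (x ^ m + x ^ (m + 2)) \<in> I"
      using rel_ideal_mult_add[OF ideal step.IH, of 1] by (simp only: mult_1_right)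
    moreover have "rel (x ^ m + x ^ (m + 2)) (x ^ Suc m) \<in> I"
      using split[of "Suc m" m "m + 2" 0] by (simp del: power_Suc)
    ultimately show ?case
      by (rule trans[OF trans])
  qed
  have "rel (x ^ 5) (1 + x ^ 3 + x ^ 5) \<in> I"
    by (rule sym[OF absorb]) simp
  moreover have "rel (1 + x ^ 3 + x ^ 5) (1 + x ^ 4) \<in> I"
    using split[of 4 3 5 1] by (simp add: add_ac)
  ultimately have "rel (x ^ 5) (1 + x ^ 4) \<in> I"
    by (rule trans)
  moreover have "rel (1 + x ^ 3 + x ^ 3) (x ^ 3) \<in> I" "rel (1 + x ^ 3 + x ^ 4) (x ^ 4) \<in> I"
    by (simp_all add: absorb)
  ultimately show ?thesis
    using rule base shift unfolding rules_def x_def[symmetric] by blast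
qed

theorem theorem5p3:
  fixes S :: "'k::field krig set"
  assumes "S =
      {rel (1 + genx ^ 2) genx,
       rel (genx + genx ^ 4) (1 + genx ^ 3),
       rel (genx ^ 5) (1 + genx ^ 4)}
      \<union> {rel (1 + genx ^ 3 + genx ^ n) (genx ^ n) | n. 3 \<le> n \<and> n \<le> 4}"
  shows "Id_gen {rel (1 + genx ^ 2) genx} = Id_gen S \<and> groebner_shirshov_basis S"
proof
  have "n = 3 \<or> n = 4" if "3 \<le> n" "n \<le> 4" for n :: nat
    using that by auto
  then have "{rel (1 + genx ^ 3 + genx ^ n) (genx ^ n) | n. 3 \<le> n \<and> n \<le> 4} =
      {rel (1 + genx ^ 3 + genx ^ 3) (genx ^ 3) :: 'k krig, rel (1 + genx ^ 3 + genx ^ 4) (genx ^ 4)}"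
    by (auto)
  then have S: "S = rule_rels"
    unfolding assms rule_rels_def rules_def by auto
  let ?B = "{rel (1 + genx ^ 2) genx} :: 'k krig set"
  show "Id_gen ?B = Id_gen S"
  proof
    show "Id_gen ?B \<subseteq> Id_gen S"
      unfolding Id_gen_def by (rule hull_mono) (simp add: assms)
    have "rel (1 + genx ^ 2) genx \<in> Id_gen ?B"
      unfolding Id_gen_def by (rule hull_inc) simp
    then have "S \<subseteq> Id_gen ?B"
      using rules_in_ideal[OF krig_ideal_Id_gen] by (auto simp: S rule_rels_def)
    then show "Id_gen S \<subseteq> Id_gen ?B"
      unfolding Id_gen_def[of S] by (rule hull_minimal) (rule krig_ideal_Id_gen)
  qed
  have "monic s" if "s \<in> S" for s
    using that by (auto simp: S rule_rels_def intro!: monic_rel rig_less_if_top_coeff_less rules_decreasing)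
  then show "groebner_shirshov_basis S"
    unfolding groebner_shirshov_basis_def using composition_trivial by (auto simp: S)
qed

end
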